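(* Let $s\ge2$, $2\le w<r<\overline{n}$, $\overline{k}=\overline{n}-r$, $\overline{d}=\overline{k}+w-1$, $N=w^{\overline{n}}$, $n=s\overline{n}$, $k=n-r$. Let $\mathbf{F}_q$ be a finite field with $q>\lceil\frac{s}{w}\rceil w\overline{n}$ and $w\mid(q-1)$. Then the $(n,k)$ MDS array code $\mathcal{C}_2$ can be obtained over $\mathbf{F}_q$: there exist pairwise distinct $\lambda_{i,u}\in\mathbf{F}_q$ ($i\in[0:\overline{n})$, $u\in[0:w)$) and $x_i\in\mathbf{F}_q\setminus\{0\}$ ($i\in[0:n)$) such that the $(n,k)$ array code over $\mathbf{F}_q$ with sub-packetization level $N$ and parity-check matrix $(A_i^t)_{t\in[0:r),i\in[0:n)}$, where $$A_i=x_i\sum_{a=0}^{N-1}\lambda_{\bar i,a_{\bar i}}e_a^\top e_a,\qquad \bar i=i\%\overline{n},$$ is an MDS array code with the $(d=n-\overline{n}+\overline{d},\,d_c=s-1)$-repair property and $\bigl(1+\frac{d_c(d-k)}{d}\bigr)$-optimal repair bandwidth (with the repair matrices $R_{i,j}$ given in the context).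
   Context: Notation: $[a:b)=\{a,\dots,b-1\}$; $\%$ is the modulo operation; $A^0=I$. $e_0,\dots,e_{N-1}$ are the standard basis row vectors of $\mathbf{F}_q^N$. For $a\in[0:N)$, $(a_0,\dots,a_{\overline{n}-1})$ is its $w$-ary expansion with $a_0$ most significant. For $i\in[0:\overline{n})$, $u\in[0:w)$, $V_{i,u}$ is the $w^{\overline{n}-1}\times w^{\overline{n}}$ matrix whose rows are the $e_a$ with $a_i=u$, in ascending order of $a$. Array codes: an $(n,k)$ array code with parity-check matrix $(A_{t,i})_{t\in[0:r),i\in[0:n)}$ ($r=n-k$, $A_{t,i}\in\mathbf{F}_q^{N\times N}$) is the set of $(\mathbf{f}_0,\dots,\mathbf{f}_{n-1})$, $\mathbf{f}_i\in\mathbf{F}_q^N$ columns, with $\sum_iA_{t,i}\mathbf{f}_i=0$ for all $t\in[0:r)$. It is MDS if every $r\times r$ sub-block matrix $(A_{t,i_j})_{t,j\in[0:r)}$, $i_0<\dots<i_{r-1}$, is non-singular (any $k$ nodes determine the codeword). Repair matrices of $\mathcal{C}_2$: $R_{i,j}=I_N$ if $j\equiv i\bmod\overline{n}$, and $R_{i,j}=V_{\bar i,0}+V_{\bar i,1}+\dots+V_{\bar i,w-1}$ otherwise. $(d,d_c)$-repair property with $(1+\epsilon)$-optimal repair bandwidth: for every node $i$ and every $d$-subset $H_i\subseteq[0:n)\setminus\{i\}$ containing the $d_c=s-1$ compulsory helper nodes $\{j\ne i:j\equiv i\bmod\overline{n}\}$, $\mathbf{f}_i$ can be recovered from the data $R_{i,j}\mathbf{f}_j$,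 $j\in H_i$, and $\gamma_i=\sum_{j\in H_i}\operatorname{rank}(R_{i,j})\le(1+\epsilon)\frac{d}{d-k+1}N$. *)

theory Defs
  imports
    Complex_Main
    "HOL-Library.FuncSet"
    "Jordan_Normal_Form.Matrix"
    "Jordan_Normal_Form.DL_Rank"
begin

text \<open>The entrywise sum of a finite family of \<open>nr\<close> by \<open>nc\<close> matrices; the library type of matrices is
  not an instance of \<^class>\<open>comm_monoid_add\<close>, so \<^const>\<open>sum\<close> does not apply to it.\<close>

definition mat_sum :: "nat \<Rightarrow> nat \<Rightarrow> ('b \<Rightarrow> 'a::comm_monoid_add mat) \<Rightarrow> 'b set \<Rightarrow> 'a mat" where
  "mat_sum nr nc F S = mat nr nc (\<lambda>(p, q). \<Sum>b\<in>S. F b $$ (p, q))"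

definition mat_rank :: "'a::field mat \<Rightarrow> nat" where
  "mat_rank M = vec_space.rank (dim_row M) M"

definition block_mat :: "nat \<Rightarrow> nat \<Rightarrow> (nat \<Rightarrow> nat \<Rightarrow> 'a mat) \<Rightarrow> 'a mat" where
  "block_mat r N B = mat (r * N) (r * N) (\<lambda>(p, q). B (p div N) (q div N) $$ (p mod N, q mod N))"

text \<open>\<open>A t i\<close> is the \<open>N\<close> by \<open>N\<close> block in block row \<open>t < n - k\<close> and block column \<open>i < n\<close>
  of a parity-check matrix.\<close>

definition array_code ::
  "nat \<Rightarrow> nat \<Rightarrow> nat \<Rightarrow> (nat \<Rightarrow> nat \<Rightarrow> 'a::field mat) \<Rightarrow> (nat \<Rightarrow> 'a vec) set" where
  "array_code n k N A = {f \<in> {..<n} \<rightarrow>\<^sub>E carrier_vec N.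
     \<forall>t<n - k. finsum_vec TYPE('a) N (\<lambda>i. A t i *\<^sub>v f i) {..<n} = 0\<^sub>v N}"

definition mds :: "nat \<Rightarrow> nat \<Rightarrow> nat \<Rightarrow> (nat \<Rightarrow> nat \<Rightarrow> 'a::field mat) \<Rightarrow> bool" where
  "mds n k N A \<longleftrightarrow>
     (\<forall>c. c \<in> {..<n - k} \<rightarrow> {..<n} \<and> strict_mono_on {..<n - k} c \<longrightarrow>
        invertible_mat (block_mat (n - k) N (\<lambda>t j. A t (c j))))"

text \<open>\<open>R i j\<close> is the matrix applied by helper node \<open>j\<close> to its column when node \<open>i\<close> is repaired, and
  \<open>K i\<close> is the set of compulsory helper nodes of node \<open>i\<close>.\<close>

definition recoverable ::
  "nat \<Rightarrow> nat \<Rightarrow> nat \<Rightarrow> (nat \<Rightarrow> nat \<Rightarrow> 'a::field mat) \<Rightarrow> (nat \<Rightarrow> nat \<Rightarrow> 'a mat) \<Rightarrow>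
    nat \<Rightarrow> nat set \<Rightarrow> bool" where
  "recoverable n k N A R i H \<longleftrightarrow>
     (\<exists>g. \<forall>f\<in>array_code n k N A. f i = g (\<lambda>j\<in>H. R i j *\<^sub>v f j))"

definition helper_sets :: "nat \<Rightarrow> nat \<Rightarrow> (nat \<Rightarrow> nat set) \<Rightarrow> nat \<Rightarrow> nat set set" where
  "helper_sets n d K i = {H. H \<subseteq> {..<n} - {i} \<and> card H = d \<and> K i \<subseteq> H}"

definition repair_property ::
  "nat \<Rightarrow> nat \<Rightarrow> nat \<Rightarrow> (nat \<Rightarrow> nat \<Rightarrow> 'a::field mat) \<Rightarrow> (nat \<Rightarrow> nat \<Rightarrow> 'a mat) \<Rightarrow>
    (nat \<Rightarrow> nat set) \<Rightarrow> nat \<Rightarrow> nat \<Rightarrow> bool" where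
  "repair_property n k N A R K d dc \<longleftrightarrow>
     (\<forall>i<n. card (K i) = dc \<and> (\<forall>H\<in>helper_sets n d K i. recoverable n k N A R i H))"

definition repair_bandwidth :: "(nat \<Rightarrow> nat \<Rightarrow> 'a::field mat) \<Rightarrow> nat \<Rightarrow> nat set \<Rightarrow> nat" where
  "repair_bandwidth R i H = (\<Sum>j\<in>H. mat_rank (R i j))"

definition near_optimal_bandwidth ::
  "real \<Rightarrow> nat \<Rightarrow> nat \<Rightarrow> nat \<Rightarrow> (nat \<Rightarrow> nat \<Rightarrow> 'a::field mat) \<Rightarrow> (nat \<Rightarrow> nat set) \<Rightarrow> nat \<Rightarrow> bool" where
  "near_optimal_bandwidth \<epsilon> n k N R K d \<longleftrightarrow>
     (\<forall>i<n. \<forall>H\<in>helper_sets n d K i.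
        real (repair_bandwidth R i H) \<le> (1 + \<epsilon>) * (real d / (real d - real k + 1)) * real N)"

text \<open>Digit \<open>i\<close> of the \<open>w\<close>-ary expansion of \<open>a < w ^ m\<close>; digit \<open>0\<close> is the most significant one.\<close>

definition digit :: "nat \<Rightarrow> nat \<Rightarrow> nat \<Rightarrow> nat \<Rightarrow> nat" where
  "digit w m a i = a div w ^ (m - 1 - i) mod w"

definition V_mat :: "nat \<Rightarrow> nat \<Rightarrow> nat \<Rightarrow> nat \<Rightarrow> 'a::field mat" where
  "V_mat w m i u =
     mat_of_rows (w ^ m) (map (unit_vec (w ^ m)) (filter (\<lambda>a. digit w m a i = u) [0..<w ^ m]))"

definition R_mat :: "nat \<Rightarrow> nat \<Rightarrow> nat \<Rightarrow> nat \<Rightarrow> 'a::field mat" where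
  "R_mat w m i j =
     (if j mod m = i mod m then 1\<^sub>m (w ^ m)
      else mat_sum (w ^ (m - 1)) (w ^ m) (\<lambda>u. V_mat w m (i mod m) u) {..<w})"

definition compulsory :: "nat \<Rightarrow> nat \<Rightarrow> nat \<Rightarrow> nat set" where
  "compulsory n m i = {j. j < n \<and> j \<noteq> i \<and> j mod m = i mod m}"

definition A_mat :: "nat \<Rightarrow> nat \<Rightarrow> (nat \<Rightarrow> nat \<Rightarrow> 'a::field) \<Rightarrow> (nat \<Rightarrow> 'a) \<Rightarrow> nat \<Rightarrow> 'a mat" where
  "A_mat w m lam x i =
     x i \<cdot>\<^sub>m mat_sum (w ^ m) (w ^ m)
       (\<lambda>a. lam (i mod m) (digit w m a (i mod m)) \<cdot>\<^sub>m
          ((mat_of_row (unit_vec (w ^ m) a))\<^sup>T * mat_of_row (unit_vec (w ^ m) a)))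
       {..<w ^ m}"

end

theory Submission
  imports Defs "HOL-Algebra.Multiplicative_Group"
begin

text \<open>All blocks are diagonal, so both the MDS property and repair split into scalar systems, each of
  which is of Vandermonde type. It remains to choose the diagonal entries such that nodes from
  different groups modulo \<open>nbar\<close> never share one; this is achieved by giving each group its own cosets
  of the group of \<open>w\<close>-th roots of unity, enough of them to contain \<open>s\<close> different scalings.\<close>

text \<open>The bound on the field size is a count: one coset of the \<open>w\<close>-th roots of
  unity yields \<open>w\<close> scalings, so a group of \<open>s\<close> nodes takes ceil(s/w)
  cosets, and \<open>nbar\<close> groups take ceil(s/w) * w * nbar nonzero elements;
  \<open>w dvd q - 1\<close> provides the roots. Nodes of one group may share diagonal entries at
  different coordinates, and all of them depend on the very digit over which repair sums. Their
  contribution to a sum of parity checks does not collapse to a single unknown, so they are made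
  compulsory helpers that send their whole column; this is the price paid beyond the optimal
  bandwidth.\<close>

section \<open>Vandermonde systems and the cyclic group of a finite field\<close>

text \<open>Gaussian elimination: subtracting \<open>v a\<close> times equation \<open>t\<close>
  from equation \<open>t + 1\<close> removes the unknown of \<open>a\<close> and multiplies every
  other \<open>y j\<close> by the nonzero \<open>v j - v a\<close>, at the cost of one equation. The
  arbitrary index type lets repair mix two kinds of unknowns.\<close>

lemma vandermonde_trivial_kernel:
  fixes v y :: "'b \<Rightarrow> 'a::field"
  assumes "finite J" "inj_on v J" "card J \<le> r"
    and "\<And>t. t < r \<Longrightarrow> (\<Sum>j\<in>J. v j ^ t * y j) = 0"
    and "j \<in> J"
  shows "y j = 0"
  using assms
proof (induction J arbitrary: r y j rule: finite_induct)
  case empty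
  then show ?case by simp
next
  case (insert a J)
  from insert.prems insert.hyps obtain r' where r: "r = Suc r'" "card J \<le> r'"
    by (cases r) auto
  have "(\<Sum>j\<in>J. v j ^ t * ((v j - v a) * y j)) = 0" if "t < r'" for t
  proof -
    have "(\<Sum>j\<in>insert a J. v j ^ Suc t * y j) - v a * (\<Sum>j\<in>insert a J. v j ^ t * y j) = 0"
      using that insert.prems(3)[of t] insert.prems(3)[of "Suc t"] r(1) by (simp only: Suc_less_eq) simp
    moreover have "(\<Sum>j\<in>insert a J. v j ^ Suc t * y j) - v a * (\<Sum>j\<in>insert a J. v j ^ t * y j)
        = (\<Sum>j\<in>insert a J. v j ^ t * ((v j - v a) * y j))"
      by (simp only: sum_distrib_left flip: sum_subtractf) (simp add: algebra_simps)
    ultimately show ?thesis using insert.hyps by simp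
  qed
  then have *: "(v j - v a) * y j = 0" if "j \<in> J" for j
    using insert.IH[of r' "\<lambda>j. (v j - v a) * y j"] insert.prems(1) r(2) that
    by (simp add: inj_on_insert)
  have J: "y j = 0" if "j \<in> J" for j
    using *[OF that] insert.prems(1) insert.hyps(2) that by (auto simp: inj_on_def)
  \<comment> \<open>All coefficients of equation 0 are 1, even where \<open>v\<close> vanishes, so
    it determines the eliminated unknown.\<close>
  have "(\<Sum>j\<in>insert a J. v j ^ 0 * y j) = 0"
    using insert.prems(3)[of 0] r by blast
  then have "y a = 0" using insert.hyps J by simp
  with J insert.prems(4) show ?case by auto
qed

lemma finite_field_generator:
  obtains \<gamma> :: "'a::{field,finite}"
  where "\<gamma> \<noteq> 0"
    and "\<And>i j. \<gamma> ^ i = \<gamma> ^ j \<Longrightarrow>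
      i mod (card (UNIV :: 'a set) - 1) = j mod (card (UNIV :: 'a set) - 1)"
proof -
  define Q where "Q = card (UNIV :: 'a set) - 1"
  have card: "card (UNIV - {0 :: 'a}) = Q" by (simp add: Q_def card_Diff_singleton)
  have "card {0, 1 :: 'a} \<le> card (UNIV :: 'a set)" by (intro card_mono) auto
  then have "Q > 0" by (simp add: Q_def)
  obtain \<gamma> :: 'a where \<gamma>: "\<gamma> \<noteq> 0" and gen: "UNIV - {0} = range (\<lambda>i. \<gamma> ^ i)"
  proof -
    have "\<exists>a\<in>UNIV - {0 :: 'a}. UNIV - {0} = range (\<lambda>i. a ^ i)"
      using field.finite_field_mult_group_has_gen[OF class_field[where 'a='a]]
      by (simp add: class_ring_simps full_SetCompr_eq)
    then show thesis using that by blast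
  qed
  \<comment> \<open>If \<open>\<gamma> ^ e = 1\<close> with \<open>e > 0\<close>, there are at most
    \<open>e\<close> different powers, yet they exhaust the \<open>Q\<close> nonzero
    elements.\<close>
  have order_ge: "Q \<le> e" if "\<gamma> ^ e = 1" "e > 0" for e
  proof -
    have "\<gamma> ^ i \<in> (\<lambda>i. \<gamma> ^ i) ` {..<e}" for i
    proof -
      have "\<gamma> ^ i = \<gamma> ^ (e * (i div e) + i mod e)" by simp
      also have "\<dots> = \<gamma> ^ (i mod e)" by (simp only: power_add power_mult that) simp
      finally show ?thesis by (rule image_eqI) (simp add: that(2))
    qed
    then have "range (\<lambda>i. \<gamma> ^ i) \<subseteq> (\<lambda>i. \<gamma> ^ i) ` {..<e}" by blast
    then have "card (UNIV - {0 :: 'a}) \<le> card ((\<lambda>i. \<gamma> ^ i) ` {..<e})"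
      unfolding gen by (rule card_mono[rotated]) simp
    also have "\<dots> \<le> e" using card_image_le[of "{..<e}"] by simp
    finally show ?thesis using card by simp
  qed
  have cancel: "\<gamma> ^ (j - i) = 1" if "\<gamma> ^ i = \<gamma> ^ j" "i \<le> j" for i j
    using that \<gamma> by (simp add: power_diff)
  \<comment> \<open>Pigeonhole on \<open>Q + 1\<close> powers gives a positive exponent of at most
    \<open>Q\<close> that yields 1, and \<open>order_ge\<close> forces it to be
    \<open>Q\<close>.\<close>
  have "\<gamma> ^ Q = 1"
  proof -
    have "\<not> inj_on (\<lambda>i. \<gamma> ^ i) {..Q}"
    proof
      assume "inj_on (\<lambda>i. \<gamma> ^ i) {..Q}"
      then have "card {..Q} \<le> card (UNIV - {0 :: 'a})"
        using \<gamma> by (intro card_inj_on_le[of "\<lambda>i. \<gamma> ^ i"]) auto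
      then show False using card by simp
    qed
    then obtain i j where ij: "i < j" "j \<le> Q" "\<gamma> ^ i = \<gamma> ^ j"
      by (meson atMost_iff linorder_inj_onI')
    then have "\<gamma> ^ (j - i) = 1" using cancel by simp
    moreover from order_ge[OF this] ij have "j - i = Q" by simp
    ultimately show ?thesis by simp
  qed
  have mod0: "e mod Q = 0" if "\<gamma> ^ e = 1" for e
  proof -
    have "\<gamma> ^ e = \<gamma> ^ (Q * (e div Q) + e mod Q)" by simp
    also have "\<dots> = \<gamma> ^ (e mod Q)" by (simp only: power_add power_mult \<open>\<gamma> ^ Q = 1\<close>) simp
    finally have "\<gamma> ^ (e mod Q) = 1" using that by simp
    with order_ge \<open>Q > 0\<close> show ?thesis
      using mod_less_divisor[of Q e] by (cases "e mod Q = 0") (simp_all add: leD)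
  qed
  have le: "i mod Q = j mod Q" if "\<gamma> ^ i = \<gamma> ^ j" "i \<le> j" for i j
  proof -
    have "Q dvd j - i" using mod0[OF cancel[OF that]] by (rule mod_0_imp_dvd)
    then show ?thesis using mod_eq_dvd_iff_nat[OF that(2)] by metis
  qed
  show thesis
  proof (rule that[OF \<gamma>])
    fix i j assume "\<gamma> ^ i = \<gamma> ^ j"
    then have "i mod Q = j mod Q"
      using le[of i j] le[of j i] by (metis nat_le_linear)
    then show "i mod (card (UNIV :: 'a set) - 1) = j mod (card (UNIV :: 'a set) - 1)"
      by (simp only: Q_def)
  qed
qed

section \<open>Diagonal blocks and the parity checks at one coordinate\<close>

text \<open>These are the diagonal entries of \<open>A_mat\<close>. Changing a digit of
  \<open>a\<close> other than digit \<open>i mod m\<close> leaves the entry of node \<open>i\<close>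
  unchanged; repair rests on this invariance.\<close>

definition node_val :: "nat \<Rightarrow> nat \<Rightarrow> (nat \<Rightarrow> nat \<Rightarrow> 'a::field) \<Rightarrow> (nat \<Rightarrow> 'a) \<Rightarrow> nat \<Rightarrow> nat \<Rightarrow> 'a" where
  "node_val w m lam x i a = x i * lam (i mod m) (digit w m a (i mod m))"

lemma unit_row_square:
  "(mat_of_row (unit_vec n a))\<^sup>T * mat_of_row (unit_vec n a :: 'a::semiring_1 vec)
   = mat n n (\<lambda>(p, q). if p = a \<and> q = a then 1 else 0)"
  by (intro eq_matI) (auto simp: scalar_prod_def unit_vec_def)

lemma A_mat_eq_diag:
  "A_mat w m lam x i = mat (w ^ m) (w ^ m) (\<lambda>(p, q). if p = q then node_val w m lam x i p else 0)"
  (is "_ = ?D")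
proof (rule eq_matI)
  fix p q assume "p < dim_row ?D" "q < dim_col ?D"
  then have pq: "p < w ^ m" "q < w ^ m" by simp_all
  let ?l = "\<lambda>a. lam (i mod m) (digit w m a (i mod m))"
  have "(\<Sum>a<w ^ m. ?l a * (if p = a \<and> q = a then 1 else 0))
      = (\<Sum>a<w ^ m. if p = a then if p = q then ?l p else 0 else 0)"
    by (intro sum.cong) auto
  also have "\<dots> = (if p = q then ?l p else 0)"
    using pq by simp
  finally show "A_mat w m lam x i $$ (p, q) = ?D $$ (p, q)"
    using pq by (simp add: A_mat_def mat_sum_def unit_row_square node_val_def)
qed (simp_all add: A_mat_def mat_sum_def)

lemma diag_pow:
  fixes f :: "nat \<Rightarrow> 'a::comm_semiring_1"
  shows "mat n n (\<lambda>(p, q). if p = q then f p else 0) ^\<^sub>m t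
    = mat n n (\<lambda>(p, q). if p = q then f p ^ t else 0)"
proof (induction t)
  case 0
  show ?case by (intro eq_matI) auto
next
  case (Suc t)
  let ?D = "\<lambda>t. mat n n (\<lambda>(p, q). if p = q then f p ^ t else 0)"
  have "?D t * mat n n (\<lambda>(p, q). if p = q then f p else 0) = ?D (Suc t)" (is "?L = ?R")
  proof (rule eq_matI)
    fix p q assume "p < dim_row ?R" "q < dim_col ?R"
    then have pq: "p < n" "q < n" by simp_all
    have "(\<Sum>c = 0..<n. (if p = c then f p ^ t else 0) * (if c = q then f c else 0))
        = (\<Sum>c = 0..<n. if p = c then if p = q then f p * f p ^ t else 0 else 0)"
      by (intro sum.cong) (auto simp: mult.commute)
    also have "\<dots> = (if p = q then f p * f p ^ t else 0)"
      using pq by simp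
    finally show "?L $$ (p, q) = ?R $$ (p, q)"
      using pq by (simp add: scalar_prod_def)
  qed simp_all
  then show ?case by (simp only: pow_mat.simps Suc)
qed

lemma diag_mult_vec:
  fixes f :: "nat \<Rightarrow> 'a::comm_semiring_1"
  assumes "v \<in> carrier_vec n" "a < n"
  shows "(mat n n (\<lambda>(p, q). if p = q then f p else 0) *\<^sub>v v) $ a = f a * v $ a"
proof -
  have "(\<Sum>c = 0..<n. (if a = c then f a else 0) * v $ c) = (\<Sum>c = 0..<n. if a = c then f a * v $ a else 0)"
    by (intro sum.cong) auto
  then show ?thesis using assms by (simp add: scalar_prod_def)
qed

lemma A_mat_pow_mult_vec:
  assumes "v \<in> carrier_vec (w ^ m)" "a < w ^ m"
  shows "(A_mat w m lam x i ^\<^sub>m t *\<^sub>v v) $ a = node_val w m lam x i a ^ t * v $ a"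
  unfolding A_mat_eq_diag diag_pow by (rule diag_mult_vec[OF assms])

lemma A_mat_pow_carrier: "A_mat w m lam x i ^\<^sub>m t \<in> carrier_mat (w ^ m) (w ^ m)"
  unfolding A_mat_eq_diag diag_pow by simp

lemma array_code_coord:
  assumes "f \<in> array_code n k (w ^ m) (\<lambda>t i. A_mat w m lam x i ^\<^sub>m t)" "t < n - k" "a < w ^ m"
  shows "(\<Sum>i<n. node_val w m lam x i a ^ t * f i $ a) = 0"
proof -
  let ?A = "\<lambda>t i. A_mat w m lam x i ^\<^sub>m t"
  have f: "f i \<in> carrier_vec (w ^ m)" if "i < n" for i
    using assms(1) that by (auto simp: array_code_def)
  have "(\<Sum>i<n. node_val w m lam x i a ^ t * f i $ a) = (\<Sum>i<n. (?A t i *\<^sub>v f i) $ a)"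
    using f assms(3) by (intro sum.cong) (simp_all only: A_mat_pow_mult_vec lessThan_iff)
  also have "\<dots> = finsum_vec TYPE('a) (w ^ m) (\<lambda>i. ?A t i *\<^sub>v f i) {..<n} $ a"
    using A_mat_pow_carrier f assms(3)
    by (intro index_finsum_vec[symmetric] Pi_I mult_mat_vec_carrier) auto
  also have "\<dots> = 0"
    using assms unfolding array_code_def by (simp only: mem_Collect_eq index_zero_vec)
  finally show ?thesis .
qed

section \<open>Inserting a digit, and the row order of \<open>V_mat\<close>\<close>

text \<open>The position \<open>e\<close> counts from the least significant end, hence the later
  argument \<open>m - 1 - i\<close>. For fixed \<open>u\<close>, the numbers with digit
  \<open>u\<close> in that place are enumerated in ascending order by \<open>p\<close>.\<close>

definition ins_digit :: "nat \<Rightarrow> nat \<Rightarrow> nat \<Rightarrow> nat \<Rightarrow> nat" where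
  "ins_digit w e p u = (p div w ^ e * w + u) * w ^ e + p mod w ^ e"

lemma ins_digit_div: "w > 0 \<Longrightarrow> ins_digit w e p u div w ^ e = p div w ^ e * w + u"
  by (simp add: ins_digit_def)

lemma ins_digit_digit_same:
  assumes "u < w"
  shows "ins_digit w e p u div w ^ e mod w = u"
  using assms by (subst ins_digit_div) auto

text \<open>Below \<open>e\<close>, the inserted digit contributes a multiple of
  \<open>w ^ (E + 1)\<close>; above \<open>e\<close>, the division discards it. Comparing with the
  insertion of 0, and not with \<open>p\<close>, avoids the shift of the higher digits.\<close>

lemma ins_digit_digit_other:
  assumes "u < w" "E \<noteq> e"
  shows "ins_digit w e p u div w ^ E mod w = ins_digit w e p 0 div w ^ E mod w"
proof (cases "E < e")
  case True
  then obtain c where c: "e = E + Suc c" by (metis add_Suc_right less_iff_Suc_add)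
  have "ins_digit w e p u div w ^ E mod w = p mod w ^ e div w ^ E mod w" if "u < w" for u
  proof -
    have "ins_digit w e p u = p mod w ^ e + ((p div w ^ e * w + u) * w ^ c * w) * w ^ E"
      unfolding ins_digit_def c by (simp add: power_add)
    then have "ins_digit w e p u div w ^ E = (p div w ^ e * w + u) * w ^ c * w + p mod w ^ e div w ^ E"
      using that by (simp only: div_mult_self1) simp
    then show ?thesis by simp
  qed
  from this[OF assms(1)] this[of 0] assms show ?thesis by simp
next
  case False
  with assms obtain c where c: "E = Suc e + c" by (metis le_add_diff_inverse not_less_eq nat_neq_iff less_imp_Suc_add add_Suc)
  have "ins_digit w e p u div w ^ E = p div w ^ e div w ^ c" if "u < w" for u
  proof -
    have "ins_digit w e p u div w ^ E = ins_digit w e p u div w ^ e div w div w ^ c"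
      unfolding c by (simp only: power_add power_Suc2 div_mult2_eq)
    also have "\<dots> = p div w ^ e div w ^ c"
      using that by (subst ins_digit_div) auto
    finally show ?thesis .
  qed
  from this[OF assms(1)] this[of 0] assms show ?thesis by simp
qed

lemma ins_digit_less:
  assumes "u < w" "p < w ^ (m - 1)" "e < m"
  shows "ins_digit w e p u < w ^ m"
proof -
  obtain c where m: "m = Suc (e + c)" using assms(3) less_iff_Suc_add by blast
  have "p div w ^ e < w ^ c"
    using assms(2) m by (simp add: power_add less_mult_imp_div_less mult.commute)
  then have "(p div w ^ e + 1) * w \<le> w ^ c * w" by (intro mult_right_mono) auto
  then have "p div w ^ e * w + u + 1 \<le> w ^ c * w" using assms(1) by simp
  then have "(p div w ^ e * w + u + 1) * w ^ e \<le> w ^ c * w * w ^ e" by (intro mult_right_mono) auto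
  moreover have "p mod w ^ e < w ^ e" using assms(1) by simp
  ultimately show ?thesis unfolding ins_digit_def m by (simp add: power_add algebra_simps)
qed

lemma ins_digit_strict_mono:
  assumes "p < p'" "u < w"
  shows "ins_digit w e p u < ins_digit w e p' u"
proof (cases "p div w ^ e = p' div w ^ e")
  case True
  moreover from this assms(1) have "p mod w ^ e < p' mod w ^ e"
    by (metis div_mult_mod_eq nat_add_left_cancel_less)
  ultimately show ?thesis by (simp add: ins_digit_def)
next
  case False
  then have "p div w ^ e + 1 \<le> p' div w ^ e"
    using assms(1) by (simp add: div_le_mono le_neq_implies_less Suc_leI)
  then have "(p div w ^ e + 1) * w * w ^ e \<le> p' div w ^ e * w * w ^ e" by (intro mult_right_mono) auto
  moreover have "(u + 1) * w ^ e \<le> w * w ^ e" using assms(2) by (intro mult_right_mono) auto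
  moreover have "p mod w ^ e < w ^ e" using assms(2) by simp
  ultimately show ?thesis unfolding ins_digit_def by (simp add: algebra_simps)
qed

lemma ins_digit_cover:
  assumes "a < w ^ m" "e < m" "w > 0"
  obtains p where "p < w ^ (m - 1)" "a = ins_digit w e p (a div w ^ e mod w)"
proof
  obtain c where m: "m = Suc (e + c)" using assms(2) less_iff_Suc_add by blast
  let ?b = "a div w ^ e div w" and ?l = "a mod w ^ e"
  \<comment> \<open>The witness is \<open>a\<close> with digit \<open>e\<close> deleted and the
    higher digits moved down one place.\<close>
  let ?p = "?b * w ^ e + ?l"
  have l: "?l < w ^ e" using assms(3) by simp
  have "?b < w ^ c"
    using assms(1) m by (simp add: power_add less_mult_imp_div_less mult.commute mult.left_commute flip: div_mult2_eq)
  then have "(?b + 1) * w ^ e \<le> w ^ c * w ^ e" by (intro mult_right_mono) auto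
  with l show "?p < w ^ (m - 1)" unfolding m by (simp add: power_add algebra_simps)
  have "?p div w ^ e = ?b" "?p mod w ^ e = ?l" using l by (simp_all add: assms(3))
  then show "a = ins_digit w e ?p (a div w ^ e mod w)"
    unfolding ins_digit_def by (metis div_mult_mod_eq)
qed

text \<open>Both lists are strictly increasing and have the same elements. This identifies row
  \<open>p\<close> of \<open>V_mat\<close> as the unit vector at an explicit coordinate.\<close>

lemma filter_digit:
  assumes "i < m" "u < w"
  shows "filter (\<lambda>a. digit w m a i = u) [0..<w ^ m]
    = map (\<lambda>p. ins_digit w (m - 1 - i) p u) [0..<w ^ (m - 1)]"
proof (rule sorted_distinct_set_unique)
  let ?e = "m - 1 - i"
  have e: "?e < m" using assms(1) by simp
  have "sorted_wrt (<) (map (\<lambda>p. ins_digit w ?e p u) [0..<w ^ (m - 1)])"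
    unfolding sorted_wrt_map
    by (rule sorted_wrt_mono_rel[of _ "(<)"]) (auto intro: ins_digit_strict_mono assms(2))
  then show "sorted (map (\<lambda>p. ins_digit w ?e p u) [0..<w ^ (m - 1)])"
    and "distinct (map (\<lambda>p. ins_digit w ?e p u) [0..<w ^ (m - 1)])"
    by (simp_all only: strict_sorted_iff)
  show "set (filter (\<lambda>a. digit w m a i = u) [0..<w ^ m])
      = set (map (\<lambda>p. ins_digit w ?e p u) [0..<w ^ (m - 1)])"
  proof (intro equalityI subsetI)
    fix a assume "a \<in> set (filter (\<lambda>a. digit w m a i = u) [0..<w ^ m])"
    then have a: "a < w ^ m" "a div w ^ ?e mod w = u" by (auto simp: digit_def)
    from ins_digit_cover[OF a(1) e] assms(2) obtain p
      where "p < w ^ (m - 1)" "a = ins_digit w ?e p (a div w ^ ?e mod w)" by auto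
    with a show "a \<in> set (map (\<lambda>p. ins_digit w ?e p u) [0..<w ^ (m - 1)])" by auto
  next
    fix a assume "a \<in> set (map (\<lambda>p. ins_digit w ?e p u) [0..<w ^ (m - 1)])"
    then show "a \<in> set (filter (\<lambda>a. digit w m a i = u) [0..<w ^ m])"
      using ins_digit_less[OF assms(2) _ e] ins_digit_digit_same[OF assms(2)]
      by (auto simp: digit_def)
  qed
qed (auto simp: sorted_wrt_filter)

lemma digit_ins_digit_same:
  "u < w \<Longrightarrow> digit w m (ins_digit w (m - 1 - i) p u) i = u"
  by (simp add: digit_def ins_digit_digit_same)

lemma digit_ins_digit_other:
  assumes "u < w" "i < m" "j < m" "j \<noteq> i"
  shows "digit w m (ins_digit w (m - 1 - i) p u) j = digit w m (ins_digit w (m - 1 - i) p 0) j"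
  unfolding digit_def using assms by (intro ins_digit_digit_other) auto

section \<open>Repair matrices, rank and invertibility\<close>

lemma R_mat_carrier:
  "R_mat w m i j \<in> carrier_mat (if j mod m = i mod m then w ^ m else w ^ (m - 1)) (w ^ m)"
  by (auto simp: R_mat_def mat_sum_def)

text \<open>The rows number \<open>p\<close> of the \<open>w\<close> summed matrices are unit
  vectors at the coordinates obtained by inserting each \<open>u\<close>. A helper from another
  group therefore sends sums over one digit of the coordinate.\<close>

lemma R_mat_mult_vec:
  fixes v :: "'a::field vec"
  assumes "m > 0" "j mod m \<noteq> i mod m" "v \<in> carrier_vec (w ^ m)" "p < w ^ (m - 1)"
  shows "(R_mat w m i j *\<^sub>v v) $ p = (\<Sum>u<w. v $ ins_digit w (m - 1 - i mod m) p u)"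
proof -
  let ?ins = "ins_digit w (m - 1 - i mod m) p"
  have im: "i mod m < m" using assms(1) by simp
  have less: "?ins u < w ^ m" if "u < w" for u
    using assms(1) by (intro ins_digit_less that assms(4)) simp
  have R: "R_mat w m i j $$ (p, c) = (\<Sum>u<w. if c = ?ins u then 1 else (0 :: 'a))" if "c < w ^ m" for c
    using assms(2,4) that less
    by (auto simp: R_mat_def mat_sum_def V_mat_def filter_digit[OF im] mat_of_rows_index intro!: sum.cong)
  have "(R_mat w m i j *\<^sub>v v) $ p = (\<Sum>c<w ^ m. R_mat w m i j $$ (p, c) * v $ c)"
    using assms by (simp add: R_mat_def mat_sum_def scalar_prod_def atLeast0LessThan)
  also have "\<dots> = (\<Sum>c<w ^ m. \<Sum>u<w. if c = ?ins u then v $ c else 0)"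
    by (auto simp: R sum_distrib_right intro!: sum.cong)
  also have "\<dots> = (\<Sum>u<w. \<Sum>c<w ^ m. if c = ?ins u then v $ c else 0)"
    by (rule sum.swap)
  also have "\<dots> = (\<Sum>u<w. v $ ?ins u)"
    using less by (intro sum.cong) auto
  finally show ?thesis .
qed

lemma mat_rank_le_dim_row: "mat_rank M \<le> dim_row M"
proof -
  interpret vec_space "TYPE('a)" "dim_row M" .
  have "VectorSpace.subspace class_ring (span (set (cols M))) V"
    by (intro span_is_subspace) (auto simp: cols_def)
  moreover have "vectorspace.fin_dim class_ring (span_vs (set (cols M)))"
    using fin_dim_span_cols by auto
  ultimately show ?thesis
    unfolding mat_rank_def rank_def using subspace_dim dim_is_n fin_dim by metis
qed

lemma invertible_mat_of_trivial_kernel: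
  fixes A :: "'a::field mat"
  assumes A: "A \<in> carrier_mat n n"
    and "\<And>v. v \<in> carrier_vec n \<Longrightarrow> A *\<^sub>v v = 0\<^sub>v n \<Longrightarrow> v = 0\<^sub>v n"
  shows "invertible_mat A"
proof -
  have "det A \<noteq> 0" using det_0_iff_vec_prod_zero[OF A] assms(2) by blast
  from det_non_zero_imp_unit[OF A this, of "()"]
  obtain B where "B \<in> carrier_mat n n" "B * A = 1\<^sub>m n" "A * B = 1\<^sub>m n"
    by (auto simp: Units_def ring_mat_def)
  with A show ?thesis by (auto simp: invertible_mat_def inverts_mat_def)
qed

section \<open>MDS property and repair from separated diagonal entries\<close>

text \<open>Nodes of different groups read different digits, which vary independently, so
  \<open>sep\<close> ranges over all pairs \<open>u\<close>, \<open>v\<close>. Nodes of one group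
  read the same digit at a given coordinate, so different scalings suffice there.\<close>

locale separated_nodes =
  fixes w m n :: nat and lam :: "nat \<Rightarrow> nat \<Rightarrow> 'a::field" and x :: "nat \<Rightarrow> 'a"
  assumes m_pos: "m > 0" and w_pos: "w > 0"
    and lam_nonzero: "\<And>i u. i < m \<Longrightarrow> u < w \<Longrightarrow> lam i u \<noteq> 0"
    and lam_inj: "\<And>i u v. i < m \<Longrightarrow> u < w \<Longrightarrow> v < w \<Longrightarrow> lam i u = lam i v \<Longrightarrow> u = v"
    and x_nonzero: "\<And>i. i < n \<Longrightarrow> x i \<noteq> 0"
    and x_inj: "\<And>i j. i < n \<Longrightarrow> j < n \<Longrightarrow> i mod m = j mod m \<Longrightarrow> x i = x j \<Longrightarrow> i = j"
    and sep: "\<And>i j u v. i < n \<Longrightarrow> j < n \<Longrightarrow> i mod m \<noteq> j mod m \<Longrightarrow> u < w \<Longrightarrow> v < w \<Longrightarrow>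
      x i * lam (i mod m) u \<noteq> x j * lam (j mod m) v"
begin

abbreviation "H_mat \<equiv> \<lambda>t i. A_mat w m lam x i ^\<^sub>m t"

lemma digit_less: "digit w m a i < w"
  using w_pos by (simp add: digit_def)

lemma node_val_inj: "inj_on (\<lambda>i. node_val w m lam x i a) {..<n}"
proof (rule inj_onI)
  fix i j assume ij: "i \<in> {..<n}" "j \<in> {..<n}" "node_val w m lam x i a = node_val w m lam x j a"
  then have "i mod m = j mod m"
    using sep[of i j] digit_less by (auto simp: node_val_def)
  moreover from this ij have "x i = x j"
    using lam_nonzero[of "i mod m"] digit_less m_pos by (simp add: node_val_def)
  ultimately show "i = j" using ij x_inj by simp
qed

lemma mds_H_mat: "mds n k (w ^ m) H_mat"
  unfolding mds_def
proof (intro allI impI)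
  fix c :: "nat \<Rightarrow> nat"
  define r N where "r = n - k" and "N = w ^ m"
  assume "c \<in> {..<n - k} \<rightarrow> {..<n} \<and> strict_mono_on {..<n - k} c"
  then have c: "c ` {..<r} \<subseteq> {..<n}" and inj_c: "inj_on c {..<r}"
    by (auto simp: r_def strict_mono_on_imp_inj_on)
  have N: "N > 0" using w_pos by (simp add: N_def)
  let ?M = "block_mat r N (\<lambda>t j. H_mat t (c j))"
  have "invertible_mat ?M"
  proof (rule invertible_mat_of_trivial_kernel)
    show M: "?M \<in> carrier_mat (r * N) (r * N)" by (simp add: block_mat_def)
    fix y assume y: "y \<in> carrier_vec (r * N)" "?M *\<^sub>v y = 0\<^sub>v (r * N)"
    have ind: "j * N + a < r * N" if "j < r" "a < N" for j a
    proof -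
      have "(j + 1) * N \<le> r * N" using that by (intro mult_right_mono) auto
      with that show ?thesis by simp
    qed
    \<comment> \<open>For each fixed coordinate \<open>a\<close>, the entries of \<open>y\<close> in
      place \<open>a\<close> of the \<open>r\<close> blocks satisfy a Vandermonde system of their
      own.\<close>
    have eq: "(\<Sum>j<r. node_val w m lam x (c j) a ^ t * y $ (j * N + a)) = 0"
      if t: "t < r" and a: "a < N" for t a
    proof -
      have entry: "?M $$ (t * N + a, q)
          = (if q mod N = a then node_val w m lam x (c (q div N)) a ^ t else 0)" if "q < r * N" for q
      proof -
        have "q mod N < N" using N by simp
        then show ?thesis using ind[OF t a] that a
          by (auto simp: block_mat_def A_mat_eq_diag diag_pow simp flip: N_def)
      qed
      have "0 = (?M *\<^sub>v y) $ (t * N + a)" using ind[OF t a] y(2) by simp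
      also have "\<dots> = (\<Sum>q<r * N. ?M $$ (t * N + a, q) * y $ q)"
        using ind[OF t a] y(1) by (simp add: scalar_prod_def block_mat_def atLeast0LessThan)
      also have "\<dots> = (\<Sum>q<r * N. if q mod N = a then node_val w m lam x (c (q div N)) a ^ t * y $ q else 0)"
        using entry by (intro sum.cong) auto
      \<comment> \<open>The only surviving columns are those congruent to \<open>a\<close> modulo
        \<open>N\<close>, one in each block.\<close>
      also have "\<dots> = (\<Sum>q\<in>(\<lambda>j. j * N + a) ` {..<r}.
          if q mod N = a then node_val w m lam x (c (q div N)) a ^ t * y $ q else 0)"
      proof (rule sum.mono_neutral_right)
        have "q \<in> (\<lambda>j. j * N + a) ` {..<r}" if "q < r * N" "q mod N = a" for q
          using that by (intro image_eqI[of _ _ "q div N"]) (auto simp: less_mult_imp_div_less)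
        then show "\<forall>q\<in>{..<r * N} - (\<lambda>j. j * N + a) ` {..<r}.
            (if q mod N = a then node_val w m lam x (c (q div N)) a ^ t * y $ q else 0) = 0"
          by auto
      qed (use ind a in auto)
      also have "\<dots> = (\<Sum>j<r. node_val w m lam x (c j) a ^ t * y $ (j * N + a))"
        using a N by (subst sum.reindex) (auto simp: inj_on_def)
      finally show ?thesis by simp
    qed
    have zero: "y $ (j * N + a) = 0" if "j < r" "a < N" for j a
    proof (rule vandermonde_trivial_kernel[where J = "{..<r}" and r = r
          and v = "\<lambda>j. node_val w m lam x (c j) a" and y = "\<lambda>j. y $ (j * N + a)"])
      show "inj_on (\<lambda>j. node_val w m lam x (c j) a) {..<r}"
        using comp_inj_on[OF inj_c inj_on_subset[OF node_val_inj c]] by (simp add: comp_def)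
    qed (use that eq in auto)
    show "y = 0\<^sub>v (r * N)"
    proof (rule eq_vecI)
      fix q assume "q < dim_vec (0\<^sub>v (r * N))"
      then have "q div N < r" "q mod N < N" using N by (simp_all add: less_mult_imp_div_less)
      from zero[OF this] show "y $ q = 0\<^sub>v (r * N) $ q" using \<open>q < _\<close> by simp
    qed (use y in simp)
  qed
  then show "invertible_mat (block_mat (n - k) (w ^ m) (\<lambda>t j. H_mat t (c j)))"
    by (simp only: r_def N_def)
qed

text \<open>Adding the \<open>w\<close> parity checks at coordinates that differ only in digit \<open>i mod m\<close> leaves the \<open>w\<close>
  unknown coordinates of node \<open>i\<close> and one unknown digit sum for each node that is not a helper; all
  the coefficients are powers of distinct elements.\<close>

lemma repair_unique:
  assumes i: "i < n" and H: "H \<subseteq> {..<n} - {i}" "compulsory n m i \<subseteq> H"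
    and card: "n - 1 - card H + w \<le> n - k"
    and f: "f \<in> array_code n k (w ^ m) H_mat" and f': "f' \<in> array_code n k (w ^ m) H_mat"
    and data: "\<And>j. j \<in> H \<Longrightarrow> R_mat w m i j *\<^sub>v f j = R_mat w m i j *\<^sub>v f' j"
  shows "f i = f' i"
proof -
  let ?nv = "node_val w m lam x" and ?e = "m - 1 - i mod m"
  \<comment> \<open>By linearity it is enough to treat the difference of two codewords, for which
    all transmitted data vanish.\<close>
  define h where "h j a = f j $ a - f' j $ a" for j a
  define U where "U = {..<n} - {i} - H"
  have im: "i mod m < m" using m_pos by simp
  have fc: "f j \<in> carrier_vec (w ^ m)" "f' j \<in> carrier_vec (w ^ m)" if "j < n" for j
    using f f' that by (auto simp: array_code_def)
  have H_less: "j < n" if "j \<in> H" for j using H(1) that by auto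
  have code: "(\<Sum>j<n. ?nv j a ^ t * h j a) = 0" if "t < n - k" "a < w ^ m" for t a
    using array_code_coord[OF f that] array_code_coord[OF f' that]
    by (simp add: h_def right_diff_distrib sum_subtractf)
  have same: "h j a = 0" if "j \<in> H" "j mod m = i mod m" "a < w ^ m" for j a
    using data[OF that(1)] fc[OF H_less[OF that(1)]] that(2) by (simp add: R_mat_def h_def)
  have helper: "(\<Sum>u<w. h j (ins_digit w ?e p u)) = 0"
    if "j \<in> H" "j mod m \<noteq> i mod m" "p < w ^ (m - 1)" for j p
    using R_mat_mult_vec[OF m_pos that(2) fc(1)[OF H_less[OF that(1)]] that(3)]
      R_mat_mult_vec[OF m_pos that(2) fc(2)[OF H_less[OF that(1)]] that(3)]
    by (simp add: h_def sum_subtractf data[OF that(1)] del: index_mult_mat_vec)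
  have U_mod: "j mod m \<noteq> i mod m" "j < n" if "j \<in> U" for j
    using that H(2) by (auto simp: U_def compulsory_def)
  have card_U: "card U = n - 1 - card H"
    using H(1) i by (simp add: U_def card_Diff_subset finite_subset)
  have "h i a = 0" if a: "a < w ^ m" for a
  proof -
    have e: "?e < m" using m_pos by simp
    obtain p u0 where p: "p < w ^ (m - 1)" and a_eq: "a = ins_digit w ?e p u0" and u0: "u0 < w"
      using ins_digit_cover[OF a e w_pos] w_pos by (metis mod_less_divisor)
    let ?I = "ins_digit w ?e p"
    have I_less: "?I u < w ^ m" if "u < w" for u
      by (rule ins_digit_less[OF that p e])
    \<comment> \<open>The sum type joins the unknowns: \<open>Inl u\<close> stands for a coordinate
      of the failed node, \<open>Inr j\<close> for the digit sum of the non-helper \<open>j\<close>.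
      Its coefficient does not depend on the inserted digit and is read off at digit 0.\<close>
    define v where "v = case_sum (\<lambda>u. x i * lam (i mod m) u) (\<lambda>j. ?nv j (?I 0))"
    define y where "y = case_sum (\<lambda>u. h i (?I u)) (\<lambda>j. \<Sum>u<w. h j (?I u))"
    define T where "T t j = (\<Sum>u<w. ?nv j (?I u) ^ t * h j (?I u))" for t j
    have T_i: "T t i = (\<Sum>u<w. v (Inl u) ^ t * y (Inl u))" for t
      unfolding T_def v_def y_def by (intro sum.cong) (simp_all add: node_val_def digit_ins_digit_same[simplified])
    have T_other: "T t j = ?nv j (?I 0) ^ t * (\<Sum>u<w. h j (?I u))" if "j mod m \<noteq> i mod m" for t j
    proof -
      have "?nv j (?I u) = ?nv j (?I 0)" if "u < w" for u
        unfolding node_val_def using digit_ins_digit_other[OF that im _ \<open>j mod m \<noteq> i mod m\<close>] m_pos by simp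
      then show ?thesis unfolding T_def sum_distrib_left
        by (intro sum.cong refl) (metis lessThan_iff)
    qed
    have T_H: "T t j = 0" if "j \<in> H" for t j
    proof (cases "j mod m = i mod m")
      case True
      with that same I_less show ?thesis by (simp add: T_def)
    next
      case False
      with that helper p show ?thesis by (simp add: T_other)
    qed
    have eq: "(\<Sum>s\<in>{..<w} <+> U. v s ^ t * y s) = 0" if t: "t < n - k" for t
    proof -
      have "0 = (\<Sum>u<w. \<Sum>j<n. ?nv j (?I u) ^ t * h j (?I u))"
        using code[OF t I_less] by simp
      also have "\<dots> = (\<Sum>j<n. T t j)" unfolding T_def by (rule sum.swap)
      also have "\<dots> = (\<Sum>j\<in>insert i U. T t j)"
        using i T_H by (intro sum.mono_neutral_right) (auto simp: U_def)
      also have "\<dots> = T t i + (\<Sum>j\<in>U. T t j)" by (simp add: U_def)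
      also have "(\<Sum>j\<in>U. T t j) = (\<Sum>j\<in>U. v (Inr j) ^ t * y (Inr j))"
        by (intro sum.cong) (simp_all add: T_other[OF U_mod(1)] v_def y_def)
      also have "T t i + \<dots> = (\<Sum>s\<in>{..<w} <+> U. v s ^ t * y s)"
        by (simp add: T_i sum.Plus U_def)
      finally show ?thesis by simp
    qed
    \<comment> \<open>Every node of \<open>U\<close> lies outside the group of \<open>i\<close>,
      because the rest of that group is among the helpers; so \<open>sep\<close> handles the mixed
      pairs.\<close>
    have "inj_on v ({..<w} <+> U)"
    proof (rule inj_onI)
      have mixed: "x i * lam (i mod m) u \<noteq> ?nv j b" if "u < w" "j \<in> U" for u j b
        unfolding node_val_def using U_mod[OF that(2)] that(1) i by (intro sep digit_less) auto
      fix s s' assume "s \<in> {..<w} <+> U" "s' \<in> {..<w} <+> U" "v s = v s'"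
      then show "s = s'"
        using lam_inj[OF im] x_nonzero[OF i] U_mod(2) inj_onD[OF node_val_inj] mixed mixed[symmetric]
        by (auto simp: v_def)
    qed
    from vandermonde_trivial_kernel[where j = "Inl u0" and r = "n - k", OF _ this _ eq]
    have "y (Inl u0) = 0" using card card_U u0 by (simp add: card_Plus U_def InlI)
    then show ?thesis by (simp add: y_def a_eq)
  qed
  then show ?thesis using fc[OF i] by (intro eq_vecI) (auto simp: h_def)
qed

text \<open>A decoder may be any function, so uniqueness suffices: choose some codeword that matches
  the received data and return its component \<open>i\<close>.\<close>

lemma recoverable_H_mat:
  assumes "i < n" "H \<subseteq> {..<n} - {i}" "compulsory n m i \<subseteq> H" "n - 1 - card H + w \<le> n - k"
  shows "recoverable n k (w ^ m) H_mat (R_mat w m) i H"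
proof -
  let ?C = "array_code n k (w ^ m) H_mat" and ?D = "\<lambda>f. \<lambda>j\<in>H. R_mat w m i j *\<^sub>v f j"
  define g where "g D = (SOME f'. f' \<in> ?C \<and> ?D f' = D)" for D
  have "f i = g (?D f) i" if "f \<in> ?C" for f
  proof (rule repair_unique[where f' = "g (?D f)", OF assms that])
    have g: "g (?D f) \<in> ?C \<and> ?D (g (?D f)) = ?D f"
      unfolding g_def by (rule someI[of _ f]) (use that in blast)
    then show "g (?D f) \<in> ?C" by blast
    fix j assume "j \<in> H"
    from g have "?D (g (?D f)) j = ?D f j" by metis
    then show "R_mat w m i j *\<^sub>v f j = R_mat w m i j *\<^sub>v g (?D f) j"
      using \<open>j \<in> H\<close> by (simp only: restrict_apply')
  qed
  then show ?thesis unfolding recoverable_def by (intro exI[of _ "\<lambda>D. g D i"]) blast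
qed

end

section \<open>Compulsory helpers and the bandwidth count\<close>

lemma finite_compulsory: "finite (compulsory n m i)"
  by (simp add: compulsory_def)

text \<open>Together with \<open>i\<close> the compulsory helpers form a full residue class modulo
  \<open>m\<close>, which has one element in each of the \<open>s\<close> intervals of length
  \<open>m\<close>.\<close>

lemma card_compulsory:
  assumes "i < s * m"
  shows "card (compulsory (s * m) m i) = s - 1"
proof -
  have m: "m > 0" using assms by (cases m) auto
  have "insert i (compulsory (s * m) m i) = (\<lambda>c. c * m + i mod m) ` {..<s}"
  proof (intro equalityI subsetI)
    fix j assume "j \<in> insert i (compulsory (s * m) m i)"
    then have "j < s * m" "j mod m = i mod m" using assms by (auto simp: compulsory_def)
    then show "j \<in> (\<lambda>c. c * m + i mod m) ` {..<s}"
      by (intro image_eqI[of _ _ "j div m"]) (auto simp: less_mult_imp_div_less, metis div_mult_mod_eq)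
  next
    fix j assume "j \<in> (\<lambda>c. c * m + i mod m) ` {..<s}"
    then obtain c where c: "j = c * m + i mod m" "c < s" by auto
    have "i mod m < m" using m by simp
    moreover have "(c + 1) * m \<le> s * m" using c by (intro mult_right_mono) auto
    ultimately show "j \<in> insert i (compulsory (s * m) m i)"
      using c by (auto simp: compulsory_def)
  qed
  moreover have "card ((\<lambda>c. c * m + i mod m) ` {..<s}) = s"
    using m by (simp add: card_image inj_on_def)
  moreover have "i \<notin> compulsory (s * m) m i" by (simp add: compulsory_def)
  ultimately show ?thesis using finite_compulsory[of "s * m" m i] by (metis card_insert_disjoint diff_Suc_1)
qed

lemma repair_bandwidth_le:
  assumes "H \<subseteq> {..<n} - {i}" "compulsory n m i \<subseteq> H"
  shows "repair_bandwidth (R_mat w m :: nat \<Rightarrow> nat \<Rightarrow> 'a::field mat) i H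
    \<le> card (compulsory n m i) * w ^ m + (card H - card (compulsory n m i)) * w ^ (m - 1)"
proof -
  let ?K = "compulsory n m i" and ?rk = "\<lambda>j. mat_rank (R_mat w m i j :: 'a mat)"
  have rank: "?rk j \<le> (if j mod m = i mod m then w ^ m else w ^ (m - 1))" for j
    using mat_rank_le_dim_row[of "R_mat w m i j :: 'a mat"] carrier_matD(1)[OF R_mat_carrier[of w m i j]]
    by metis
  have finH: "finite H" using assms(1) finite_subset by blast
  have "repair_bandwidth (R_mat w m :: nat \<Rightarrow> nat \<Rightarrow> 'a mat) i H = (\<Sum>j\<in>H - ?K. ?rk j) + (\<Sum>j\<in>?K. ?rk j)"
    unfolding repair_bandwidth_def by (rule sum.subset_diff[OF assms(2) finH])
  also have "(\<Sum>j\<in>?K. ?rk j) \<le> of_nat (card ?K) * w ^ m"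
    by (rule sum_bounded_above) (use rank in \<open>auto simp: compulsory_def split: if_splits\<close>, metis)
  also have "(\<Sum>j\<in>H - ?K. ?rk j) \<le> of_nat (card (H - ?K)) * w ^ (m - 1)"
  proof (rule sum_bounded_above)
    fix j assume "j \<in> H - ?K"
    then have "j mod m \<noteq> i mod m" using assms(1) by (auto simp: compulsory_def)
    then show "?rk j \<le> w ^ (m - 1)" using rank[of j] by simp
  qed
  also have "card (H - ?K) = card H - card ?K"
    using assms(2) finite_compulsory by (rule card_Diff_subset[rotated])
  finally show ?thesis by simp
qed

section \<open>Choice of the diagonal entries in the finite field\<close>

text \<open>The factors \<open>\<gamma> ^ (M * u)\<close> below run through the \<open>w\<close>-th roots of unity, whose cosets are the
  classes of exponents modulo \<open>M\<close>; group \<open>i\<close> owns the classes congruent to \<open>i\<close> modulo \<open>m\<close>.\<close>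

lemma separated_nodes_exist:
  fixes w m s P :: nat
  assumes "w > 0" "m > 0" "s > 0" "s \<le> P * w"
    and dvd: "w dvd card (UNIV :: 'a::{field,finite} set) - 1"
    and large: "P * m * w \<le> card (UNIV :: 'a set) - 1"
  obtains lam :: "nat \<Rightarrow> nat \<Rightarrow> 'a::{field,finite}" and x
  where "inj_on (\<lambda>(i, u). lam i u) ({..<m} \<times> {..<w})" "separated_nodes w m (s * m) lam x"
proof -
  define K where "K = card (UNIV :: 'a set) - 1"
  obtain M where K: "K = M * w" using dvd unfolding K_def by (metis dvd_div_mult_self)
  have M: "P * m \<le> M" using large assms(1) unfolding K_def[symmetric] K by simp
  obtain \<gamma> :: 'a where \<gamma>: "\<gamma> \<noteq> 0" and pow_eq: "\<And>i j. \<gamma> ^ i = \<gamma> ^ j \<Longrightarrow> i mod K = j mod K"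
    using finite_field_generator unfolding K_def by blast
  \<comment> \<open>As \<open>M\<close> divides \<open>K\<close>, the class modulo \<open>M\<close>
    of an exponent is determined by the power itself: it names the coset.\<close>
  have pow_eq_M: "a = b" if "\<gamma> ^ (a + M * u) = \<gamma> ^ (b + M * v)" "a < M" "b < M" for a b u v
  proof -
    have "(a + M * u) mod K mod M = (b + M * v) mod K mod M" by (simp only: pow_eq[OF that(1)])
    then show ?thesis using that(2,3) by (simp add: K mod_mod_cancel)
  qed
  have pow_inj: "a = b \<and> u = v"
    if eq: "\<gamma> ^ (a + M * u) = \<gamma> ^ (b + M * v)" and "a < M" "b < M" "u < w" "v < w" for a b u v
  proof -
    have less: "c + M * t < K" if "c < M" "t < w" for c t
    proof -
      have "M * (t + 1) \<le> M * w" using that(2) by (intro mult_left_mono) auto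
      then show ?thesis using that(1) by (simp add: K)
    qed
    have ab: "a = b" by (rule pow_eq_M[OF that(1-3)])
    have "a + M * u = b + M * v"
      using pow_eq[OF eq] less[OF that(2,4)] less[OF that(3,5)] by simp
    then show ?thesis using ab that(2) by simp
  qed
  have class_less: "m * p + i < M" if "p < P" "i < m" for p i
  proof -
    have "m * (p + 1) \<le> m * P" using that(1) by (intro mult_left_mono) auto
    then show ?thesis using that(2) M by (simp add: mult.commute)
  qed
  have P: "P > 0" using assms(3,4) by (cases P) auto
  \<comment> \<open>\<open>j div m\<close> is the index of node \<open>j\<close> within its group.
    Its quotient by \<open>w\<close>, less than \<open>P\<close>, selects a coset and its remainder
    a root of unity within it. The coset of \<open>x j\<close> is a multiple of \<open>m\<close>, so
    multiplying by \<open>lam (j mod m) u\<close> stays in the classes owned by the group.\<close>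
  define lam where "lam i u = \<gamma> ^ (i + M * u)" for i u
  define x where "x j = \<gamma> ^ (m * (j div m div w) + M * (j div m mod w))" for j
  have lt_P: "j div m div w < P" if "j < s * m" for j
  proof -
    have "j div m < P * w" using that assms(4) less_mult_imp_div_less by fastforce
    then show ?thesis by (rule less_mult_imp_div_less)
  qed
  have inj: "inj_on (\<lambda>(i, u). lam i u) ({..<m} \<times> {..<w})"
  proof (rule inj_onI, clarify)
    fix i u j v assume *: "i < m" "u < w" "j < m" "v < w" "lam i u = lam j v"
    have "i < M" "j < M" using class_less[OF P, of i] class_less[OF P, of j] * by auto
    with * show "i = j \<and> u = v" using pow_inj[of i u j v] by (simp add: lam_def)
  qed
  have "separated_nodes w m (s * m) lam x"
  proof
    show "u = v" if "i < m" "u < w" "v < w" "lam i u = lam i v" for i u v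
      using inj_onD[OF inj, of "(i, u)" "(i, v)"] that by simp
    show "i = j" if "i < s * m" "j < s * m" "i mod m = j mod m" "x i = x j" for i j
    proof -
      have "m * (i div m div w) = m * (j div m div w) \<and> i div m mod w = j div m mod w"
        using that class_less[OF lt_P, of i 0] class_less[OF lt_P, of j 0] assms(1,2)
        by (intro pow_inj) (simp_all add: x_def)
      then have "i div m = j div m" using assms(2) by (metis div_mult_mod_eq mult_cancel1 not_gr0)
      with that(3) show ?thesis by (metis div_mult_mod_eq)
    qed
    show "x i * lam (i mod m) u \<noteq> x j * lam (j mod m) v"
      if "i < s * m" "j < s * m" "i mod m \<noteq> j mod m" for i j u v
    proof
      have prod: "x i * lam (i mod m) u
          = \<gamma> ^ (m * (i div m div w) + i mod m + M * (i div m mod w + u))" for i u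
        by (simp add: x_def lam_def distrib_left ac_simps flip: power_add)
      assume "x i * lam (i mod m) u = x j * lam (j mod m) v"
      \<comment> \<open>Both sides are below \<open>M\<close>, so equal powers have equal classes;
        reducing these modulo \<open>m\<close> recovers the groups.\<close>
      then have "m * (i div m div w) + i mod m = m * (j div m div w) + j mod m"
        unfolding prod by (rule pow_eq_M) (intro class_less lt_P that mod_less_divisor assms(2))+
      then have "(m * (i div m div w) + i mod m) mod m = (m * (j div m div w) + j mod m) mod m"
        by (simp only:)
      with that(3) show False by simp
    qed
  qed (use assms \<gamma> in \<open>simp_all add: lam_def x_def\<close>)
  with inj show thesis by (rule that)
qed

theorem theorem6:
  fixes s w r nbar kbar dbar N n k d dc q :: nat
  assumes "s \<ge> 2"
    and "2 \<le> w" and "w < r" and "r < nbar"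
    and "kbar = nbar - r"
    and "dbar = kbar + w - 1"
    and "N = w ^ nbar"
    and "n = s * nbar"
    and "k = n - r"
    and "d = n - nbar + dbar"
    and "dc = s - 1"
    and "q = card (UNIV :: 'a::{field,finite} set)"
    and "int q > \<lceil>real s / real w\<rceil> * int w * int nbar"
    and "w dvd q - 1"
  shows "\<exists>(lam :: nat \<Rightarrow> nat \<Rightarrow> 'a) (x :: nat \<Rightarrow> 'a).
    inj_on (\<lambda>(i, u). lam i u) ({..<nbar} \<times> {..<w}) \<and>
    (\<forall>i<n. x i \<noteq> 0) \<and>
    mds n k N (\<lambda>t i. A_mat w nbar lam x i ^\<^sub>m t) \<and>
    repair_property n k N (\<lambda>t i. A_mat w nbar lam x i ^\<^sub>m t) (R_mat w nbar) (compulsory n nbar) d dc \<and>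
    near_optimal_bandwidth (real dc * (real d - real k) / real d) n k N
      (R_mat w nbar :: nat \<Rightarrow> nat \<Rightarrow> 'a mat) (compulsory n nbar) d"
proof -
  define P where "P = nat \<lceil>real s / real w\<rceil>"
  have ceil: "\<lceil>real s / real w\<rceil> = int P"
    unfolding P_def by (subst int_nat_eq) (simp add: order_less_le_trans[of _ 0])
  have "real s / real w \<le> real P" unfolding P_def by (simp add: real_nat_ceiling_ge)
  then have "real s \<le> real (P * w)" using \<open>2 \<le> w\<close> by (simp add: field_simps)
  then have sP: "s \<le> P * w" by linarith
  have "int (P * nbar * w) < int q"
    using assms(13) unfolding ceil by (simp add: mult.commute mult.left_commute)
  then have large: "P * nbar * w \<le> q - 1" by linarith
  obtain lam :: "nat \<Rightarrow> nat \<Rightarrow> 'a" and x where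
    inj: "inj_on (\<lambda>(i, u). lam i u) ({..<nbar} \<times> {..<w})" and "separated_nodes w nbar n lam x"
    using separated_nodes_exist[of w nbar s P] sP large assms by auto
  then interpret separated_nodes w nbar n lam x by simp
  have "nbar \<le> n" using \<open>s \<ge> 2\<close> \<open>n = s * nbar\<close> by simp
  \<comment> \<open>The number of helpers is tuned so that \<open>w\<close> coordinates of the
    failed node and \<open>n - 1 - d\<close> digit sums make exactly \<open>r\<close> unknowns, one
    per parity check.\<close>
  have n_k: "n - k = r" and d_eq: "d + r + 1 = n + w" and d_k: "d = k + w - 1"
    using \<open>nbar \<le> n\<close> assms(2-6,9,10) by linarith+
  have card_K: "card (compulsory n nbar i) = dc" if "i < n" for i
    using card_compulsory that assms by simp
  have "recoverable n k N H_mat (R_mat w nbar) i H"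
    if "i < n" "H \<in> helper_sets n d (compulsory n nbar) i" for i H
    unfolding \<open>N = w ^ nbar\<close> using that d_eq n_k \<open>w < r\<close>
    by (intro recoverable_H_mat) (auto simp: helper_sets_def)
  then have "repair_property n k N H_mat (R_mat w nbar) (compulsory n nbar) d dc"
    using card_K by (simp add: repair_property_def)
  moreover have "near_optimal_bandwidth (real dc * (real d - real k) / real d) n k N
      (R_mat w nbar :: nat \<Rightarrow> nat \<Rightarrow> 'a mat) (compulsory n nbar) d"
    unfolding near_optimal_bandwidth_def
  proof (intro allI impI ballI)
    fix i H assume i: "i < n" and H: "H \<in> helper_sets n d (compulsory n nbar) i"
    then have sub: "H \<subseteq> {..<n} - {i}" "compulsory n nbar i \<subseteq> H" and card: "card H = d"
      by (auto simp: helper_sets_def)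
    have "dc \<le> d"
      using card_mono[OF finite_subset[OF sub(1)] sub(2)] card card_K[OF i] by simp
    have N: "real N = real w * real (w ^ (nbar - 1))"
      using \<open>N = w ^ nbar\<close> m_pos by (simp flip: power_Suc)
    have dk: "real d - real k = real w - 1" using d_k \<open>2 \<le> w\<close> by simp
    have "d > 0" using d_k \<open>2 \<le> w\<close> by simp
    have "repair_bandwidth (R_mat w nbar :: nat \<Rightarrow> nat \<Rightarrow> 'a mat) i H \<le> dc * N + (d - dc) * w ^ (nbar - 1)"
      using repair_bandwidth_le[OF sub, of w] card card_K[OF i] \<open>N = w ^ nbar\<close> by simp
    then have "real (repair_bandwidth (R_mat w nbar :: nat \<Rightarrow> nat \<Rightarrow> 'a mat) i H)
        \<le> real (dc * N + (d - dc) * w ^ (nbar - 1))"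
      by (simp only: of_nat_le_iff)
    also have "\<dots> = real dc * real N + (real d - real dc) * real (w ^ (nbar - 1))"
      using \<open>dc \<le> d\<close> by (simp only: of_nat_add of_nat_mult of_nat_diff)
    \<comment> \<open>Since \<open>d - k + 1 = w\<close>, the right side is
      \<open>(d + dc * (w - 1)) * N / w\<close>, so the bound on the traffic is met with
      equality.\<close>
    also have "\<dots> = (1 + real dc * (real d - real k) / real d) * (real d / (real d - real k + 1)) * real N"
      unfolding dk N using \<open>d > 0\<close> \<open>2 \<le> w\<close> by (simp add: field_simps)
    finally show "real (repair_bandwidth (R_mat w nbar :: nat \<Rightarrow> nat \<Rightarrow> 'a mat) i H)
        \<le> (1 + real dc * (real d - real k) / real d) * (real d / (real d - real k + 1)) * real N" .
  qed
  moreover have "mds n k N H_mat" using mds_H_mat \<open>N = w ^ nbar\<close> by simp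
  ultimately show ?thesis using inj x_nonzero by blast
qed

end
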